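(* For any positive integer $n$, the total number $N(P_3\times P_n)$ of connected sets of $P_3\times P_n$ is $$N(P_3\times P_n)=\sum_{k=1}^{n}(N_{3,k}-|\mathcal C'_{3,k}|)\cdot(n-k+1).$$
   Context: All graphs are finite and simple; $K_m$, $P_n$ are the complete graph and path of order $m$, $n$. The Cartesian product $G\times H$ has vertex set $V(G)\times V(H)$ and edges $(u_1,v_1)(u_2,v_2)$ with either $u_1u_2\in E(G)$, $v_1=v_2$, or $v_1v_2\in E(H)$, $u_1=u_2$. A connected set of $G$ is a nonempty $C\subseteq V(G)$ with $G[C]$ connected; $\mathcal C(G)$ is the set of all connected sets and $N(G)=|\mathcal C(G)|$. $K_3\times P_k$ and $P_3\times P_k$ have the same vertex set $\{v_{i,j}:1\le i\le 3,\ 1\le j\le k\}$ ($i$ the coordinate in $K_3$ resp. $P_3$, where $v_{i_1,j}v_{i_2,j}$ is an edge of $P_3\times P_k$ iff $|i_1-i_2|=1$); the $j$-th column is $\{v_{1,j},v_{2,j},v_{3,j}\}$. $N_{3,k}$ is the number of connected sets of $K_3\times P_k$ containing at least one vertex in each column; it is given by $N_{3,k}=\mathbf{u_1}\cdot T_1^{k-1}\mathbf 1$ with $\mathbf{u_1}=\begin{bmatrix}3&3&1\end{bmatrix}$, $\mathbf{1}$ the all-ones column vector, and $T_1=\begin{bmatrix}1&2&1\\2&3&1\\3&3&1\end{bmatrix}$. $\mathcal C'_{3,k}$ is the set of elements of $\mathcal C(K_3\times P_k)\setminus\mathcal C(P_3\times P_k)$ containing at least one vertex in each column. *)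

theory Defs
  imports "Graph_Theory.Graph_Theory"
begin

text \<open>A finite simple graph is a \<^locale>\<open>pair_graph\<close>: a finite, loopfree, symmetric digraph whose
  arcs are pairs of vertices; each edge \<open>uv\<close> is represented by both \<open>(u, v)\<close> and \<open>(v, u)\<close>.
  Coordinates of vertices run through \<open>{1..m}\<close>, as in \<open>v\<^sub>i\<^sub>,\<^sub>j\<close> with \<open>1 \<le> i \<le> 3\<close>, \<open>1 \<le> j \<le> k\<close>.\<close>

definition complete_graph :: "nat \<Rightarrow> nat pair_pre_digraph" where
  "complete_graph m =
     \<lparr> pverts = {1..m}, parcs = {(i, j). i \<in> {1..m} \<and> j \<in> {1..m} \<and> i \<noteq> j} \<rparr>"

definition path_graph :: "nat \<Rightarrow> nat pair_pre_digraph" where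
  "path_graph n =
     \<lparr> pverts = {1..n},
       parcs = {(i, j). i \<in> {1..n} \<and> j \<in> {1..n} \<and> (j = i + 1 \<or> i = j + 1)} \<rparr>"

definition cart_prod ::
    "'a pair_pre_digraph \<Rightarrow> 'b pair_pre_digraph \<Rightarrow> ('a \<times> 'b) pair_pre_digraph" where
  "cart_prod G H =
     \<lparr> pverts = pverts G \<times> pverts H,
       parcs = {((u\<^sub>1, v\<^sub>1), (u\<^sub>2, v\<^sub>2)).
         (u\<^sub>1, v\<^sub>1) \<in> pverts G \<times> pverts H \<and> (u\<^sub>2, v\<^sub>2) \<in> pverts G \<times> pverts H \<and>
         ((u\<^sub>1, u\<^sub>2) \<in> parcs G \<and> v\<^sub>1 = v\<^sub>2 \<or> (v\<^sub>1, v\<^sub>2) \<in> parcs H \<and> u\<^sub>1 = u\<^sub>2)} \<rparr>"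

definition conn_sets :: "'a pair_pre_digraph \<Rightarrow> 'a set set" where
  "conn_sets G =
     {C. C \<noteq> {} \<and> C \<subseteq> pverts G \<and> Digraph_Component.connected (with_proj G \<restriction> C)}"

definition num_conn_sets :: "'a pair_pre_digraph \<Rightarrow> nat" where
  "num_conn_sets G = card (conn_sets G)"

definition column :: "nat \<Rightarrow> (nat \<times> nat) set" where
  "column j = {(1, j), (2, j), (3, j)}"

definition meets_all_columns :: "nat \<Rightarrow> (nat \<times> nat) set \<Rightarrow> bool" where
  "meets_all_columns k C \<longleftrightarrow> (\<forall>j\<in>{1..k}. C \<inter> column j \<noteq> {})"

text \<open>The number \<open>N\<^sub>3\<^sub>,\<^sub>k\<close> and the family \<open>C'\<^sub>3\<^sub>,\<^sub>k\<close>.\<close>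

definition N3 :: "nat \<Rightarrow> nat" where
  "N3 k = card {C \<in> conn_sets (cart_prod (complete_graph 3) (path_graph k)).
                  meets_all_columns k C}"

definition C3' :: "nat \<Rightarrow> (nat \<times> nat) set set" where
  "C3' k = {C \<in> conn_sets (cart_prod (complete_graph 3) (path_graph k)) -
                conn_sets (cart_prod (path_graph 3) (path_graph k)).
              meets_all_columns k C}"

lemma pair_graph_complete_graph: "pair_graph (complete_graph m)"
  by unfold_locales
    (auto simp: complete_graph_def symmetric_def intro!: symI
      intro: finite_subset[where B = "{1..m} \<times> {1..m}"])

lemma pair_graph_path_graph: "pair_graph (path_graph n)"
  by unfold_locales
    (auto simp: path_graph_def symmetric_def intro!: symI
      intro: finite_subset[where B = "{1..n} \<times> {1..n}"])

lemma complete_digraph_complete_graph: "complete_digraph m (with_proj (complete_graph m))"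
  by (auto simp: complete_digraph_pair_def complete_graph_def)

lemma pair_graph_cart_prod:
  assumes "pair_graph G" "pair_graph H"
  shows "pair_graph (cart_prod G H)"
proof -
  interpret G: pair_graph G by fact
  interpret H: pair_graph H by fact
  have sG: "(v, u) \<in> parcs G" if "(u, v) \<in> parcs G" for u v
    using that G.pair_sym_arcs by (auto simp: symmetric_def dest: symD)
  have sH: "(v, u) \<in> parcs H" if "(u, v) \<in> parcs H" for u v
    using that H.pair_sym_arcs by (auto simp: symmetric_def dest: symD)
  let ?V = "pverts G \<times> pverts H"
  have fin: "finite (?V \<times> ?V)"
    using G.pair_finite_verts H.pair_finite_verts by simp
  have "parcs (cart_prod G H) \<subseteq> ?V \<times> ?V"
    by (auto simp: cart_prod_def)
  with fin have "finite (parcs (cart_prod G H))"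
    by (rule rev_finite_subset)
  moreover have "symmetric (with_proj (cart_prod G H))"
    unfolding symmetric_def by (rule symI) (auto simp: cart_prod_def intro: sG sH)
  ultimately show ?thesis
    using G.pair_finite_verts H.pair_finite_verts
    by unfold_locales
      (auto simp: cart_prod_def dest: G.pair_no_loops H.pair_no_loops)
qed

end

theory Submission
  imports Defs
begin

text \<open>The columns met by a connected set form an interval, so every connected set of
  \<open>G \<times> P\<^sub>n\<close> is a unique translate of a connected set of some \<open>G \<times> P\<^sub>k\<close> meeting all
  \<open>k\<close> columns, and there are \<open>n - k + 1\<close> such translates inside \<open>G \<times> P\<^sub>n\<close>. For \<open>G = P\<^sub>3\<close>, the sets
  meeting all columns are counted by \<open>N\<^sub>3\<^sub>,\<^sub>k\<close> minus those that are connected only in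
  \<open>K\<^sub>3 \<times> P\<^sub>k\<close>.\<close>

text \<open>Stating the condition through \<open>snd\<close> makes sense for any first factor,
  whereas \<open>column\<close> fixes three rows, and it turns shifts of sets into shifts of
  intervals.\<close>

definition spanning_conn_sets :: "'a pair_pre_digraph \<Rightarrow> nat \<Rightarrow> ('a \<times> nat) set set" where
  "spanning_conn_sets G k = {C \<in> conn_sets (cart_prod G (path_graph k)). snd ` C = {1..k}}"

text \<open>A walk counted by \<open>rtrancl_on C\<close> never leaves \<open>C\<close>, so arcs
  need to be preserved only between points of \<open>C\<close>.\<close>

lemma rtrancl_on_image:
  assumes "(u, v) \<in> rtrancl_on C r"
    and "\<And>x y. x \<in> C \<Longrightarrow> y \<in> C \<Longrightarrow> (x, y) \<in> r \<Longrightarrow> (f x, f y) \<in> s"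
  shows "(f u, f v) \<in> rtrancl_on (f ` C) s"
  using assms(1)
proof (induction rule: rtrancl_on_induct)
  case (step y z)
  then show ?case
    using assms(2) by (blast intro: rtrancl_on_into_rtrancl_on)
qed simp

lemma conn_sets_iff:
  "C \<in> conn_sets G \<longleftrightarrow> C \<noteq> {} \<and> C \<subseteq> pverts G \<and>
    (\<forall>u\<in>C. \<forall>v\<in>C. (u, v) \<in> rtrancl_on C (parcs G \<union> (parcs G)\<inverse>))"
proof -
  let ?S = "parcs (mk_symmetric (with_proj G \<restriction> C))"
  have S: "(x, y) \<in> ?S \<longleftrightarrow> (x, y) \<in> parcs G \<union> (parcs G)\<inverse>" if "x \<in> C" "y \<in> C" for x y
    using that by (force simp: parcs_mk_symmetric)
  have "(u, v) \<in> rtrancl_on C ?S \<longleftrightarrow> (u, v) \<in> rtrancl_on C (parcs G \<union> (parcs G)\<inverse>)" for u v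
    using rtrancl_on_image[of u v C ?S id "parcs G \<union> (parcs G)\<inverse>"]
      rtrancl_on_image[of u v C "parcs G \<union> (parcs G)\<inverse>" id ?S] S by auto
  then show ?thesis
    by (auto simp: conn_sets_def connected_def strongly_connected_def reachable_def)
qed

text \<open>Walks map to walks. This serves shifts in both directions and, with \<open>id\<close>,
  the passage from a subgraph to a larger graph on the same vertices.\<close>

lemma conn_sets_image:
  assumes "C \<in> conn_sets G" and "f ` C \<subseteq> pverts H"
    and "\<And>u v. u \<in> C \<Longrightarrow> v \<in> C \<Longrightarrow> (u, v) \<in> parcs G \<Longrightarrow> (f u, f v) \<in> parcs H"
  shows "f ` C \<in> conn_sets H"
proof -
  have "(f u, f v) \<in> rtrancl_on (f ` C) (parcs H \<union> (parcs H)\<inverse>)" if "u \<in> C" "v \<in> C" for u v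
    using assms(1,3) that
    by (intro rtrancl_on_image[where r = "parcs G \<union> (parcs G)\<inverse>"]) (auto simp: conn_sets_iff)
  then show ?thesis
    using assms(1,2) by (auto simp: conn_sets_iff)
qed

lemma finite_conn_sets: "finite (pverts G) \<Longrightarrow> finite (conn_sets G)"
  by (rule finite_subset[of _ "Pow (pverts G)"]) (auto simp: conn_sets_def)

text \<open>A discrete intermediate value argument: each arc changes the column by at most one, so a
  walk cannot jump over column \<open>j\<close>.\<close>

lemma snd_image_conn_set_convex:
  assumes C: "C \<in> conn_sets (cart_prod G (path_graph n))"
    and "u \<in> C" "v \<in> C" "snd u \<le> j" "j \<le> snd v"
  shows "j \<in> snd ` C"
proof -
  let ?r = "parcs (cart_prod G (path_graph n))"
  have "(u, v) \<in> rtrancl_on C (?r \<union> ?r\<inverse>)"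
    using C assms(2,3) by (auto simp: conn_sets_iff)
  \<comment> \<open>The bound on the endpoint stays inside the induction as a premise, since it must
    vary along the walk.\<close>
  then have "j \<le> snd v \<longrightarrow> j \<in> snd ` C"
  proof (induction rule: rtrancl_on_induct)
    case base
    then show ?case using \<open>snd u \<le> j\<close> by auto
  next
    case (step y z)
    have "snd z \<le> Suc (snd y)"
      using step.hyps(2) by (auto simp: cart_prod_def path_graph_def)
    \<comment> \<open>Either \<open>z\<close> itself lies in column \<open>j\<close>, or
      \<open>j\<close> is at most \<open>snd y\<close> and the induction hypothesis applies.\<close>
    with step show ?case by (cases "j = snd z") auto
  qed
  with \<open>j \<le> snd v\<close> show ?thesis by blast
qed

lemma snd_image_conn_set_interval:
  assumes C: "C \<in> conn_sets (cart_prod G (path_graph n))"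
  obtains a k where "1 \<le> k" "a + k \<le> n" "snd ` C = {a + 1..a + k}"
proof -
  have sub: "snd ` C \<subseteq> {1..n}" and ne: "snd ` C \<noteq> {}"
    using C by (auto simp: conn_sets_iff cart_prod_def path_graph_def)
  have fin: "finite (snd ` C)"
    using sub by (rule finite_subset) simp
  define p q where "p = Min (snd ` C)" and "q = Max (snd ` C)"
  have p: "p \<in> snd ` C" and q: "q \<in> snd ` C"
    using fin ne by (simp_all add: p_def q_def)
  have "p \<le> q" using fin q by (simp add: p_def)
  have "snd ` C = {p..q}"
  proof
    show "snd ` C \<subseteq> {p..q}"
      using fin by (intro subsetI) (simp add: p_def q_def)
    show "{p..q} \<subseteq> snd ` C"
      using p q snd_image_conn_set_convex[OF C] by fastforce
  qed
  moreover have "1 \<le> p" "q \<le> n" using p q sub by auto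
  \<comment> \<open>The offset \<open>p - 1\<close> is exact because columns are numbered from
    1.\<close>
  ultimately show thesis
    using \<open>p \<le> q\<close> that[of "q - p + 1" "p - 1"] by simp
qed

lemma translate_conn_set:
  assumes C: "C \<in> conn_sets (cart_prod G (path_graph k))" and "a + k \<le> n"
  shows "map_prod id ((+) a) ` C \<in> conn_sets (cart_prod G (path_graph n))"
  using C
proof (rule conn_sets_image)
  show "map_prod id ((+) a) ` C \<subseteq> pverts (cart_prod G (path_graph n))"
    using assms by (fastforce simp: conn_sets_iff cart_prod_def path_graph_def)
qed (use \<open>a + k \<le> n\<close> in \<open>auto simp: cart_prod_def path_graph_def\<close>)

lemma untranslate_conn_set:
  assumes C: "C \<in> conn_sets (cart_prod G (path_graph n))" and cols: "snd ` C = {a + 1..a + k}"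
  shows "map_prod id (\<lambda>j. j - a) ` C \<in> conn_sets (cart_prod G (path_graph k))"
  using C
proof (rule conn_sets_image)
  \<comment> \<open>On \<open>C\<close> the truncated subtraction \<open>j - a\<close> is a true
    one, so it keeps neighbouring columns neighbouring.\<close>
  have col: "a + 1 \<le> j \<and> j \<le> a + k" if "(x, j) \<in> C" for x j
    using imageI[OF that, of snd] cols by simp
  have "C \<subseteq> pverts G \<times> {1..n}"
    using C by (auto simp: conn_sets_iff cart_prod_def path_graph_def)
  then show "map_prod id (\<lambda>j. j - a) ` C \<subseteq> pverts (cart_prod G (path_graph k))"
    by (fastforce simp: cart_prod_def path_graph_def dest: col)
  fix u v assume "u \<in> C" "v \<in> C" "(u, v) \<in> parcs (cart_prod G (path_graph n))"
  then show "(map_prod id (\<lambda>j. j - a) u, map_prod id (\<lambda>j. j - a) v)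
      \<in> parcs (cart_prod G (path_graph k))"
    by (cases u; cases v) (auto simp: cart_prod_def path_graph_def dest!: col)
qed

lemma snd_translate: "snd ` C = {1..k} \<Longrightarrow> snd ` map_prod id ((+) a) ` C = {a + 1..a + k}"
  for a k :: nat
proof -
  assume "snd ` C = {1..k}"
  have "snd ` map_prod id ((+) a) ` C = (+) a ` (snd ` C)"
    by (simp add: image_image)
  then show ?thesis
    using \<open>snd ` C = {1..k}\<close> by (simp add: add.commute)
qed

text \<open>A triple records the width, the offset and the set moved back to start at column 1. The
  interval of columns of the translate recovers width and offset, and the shift itself is
  injective.\<close>

lemma bij_betw_translate:
  "bij_betw (\<lambda>(k, a, C). map_prod id ((+) a) ` C)
    (SIGMA k:{1..n}. {..n - k} \<times> spanning_conn_sets G k)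
    (conn_sets (cart_prod G (path_graph n)))"
  unfolding bij_betw_def
proof (intro conjI subset_antisym)
  show "inj_on (\<lambda>(k, a, C). map_prod id ((+) a) ` C)
      (SIGMA k:{1..n}. {..n - k} \<times> spanning_conn_sets G k)"
  proof (rule inj_onI, clarsimp)
    fix k a C k' a' C'
    assume k: "Suc 0 \<le> k" "Suc 0 \<le> k'"
      and C: "C \<in> spanning_conn_sets G k" "C' \<in> spanning_conn_sets G k'"
      and eq: "map_prod id ((+) a) ` C = map_prod id ((+) a') ` C'"
    have "{a + 1..a + k} = snd ` map_prod id ((+) a) ` C"
      using C by (intro snd_translate[symmetric]) (simp add: spanning_conn_sets_def)
    also have "\<dots> = {a' + 1..a' + k'}"
      unfolding eq using C by (intro snd_translate) (simp add: spanning_conn_sets_def)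
    finally have "{a + 1..a + k} = {a' + 1..a' + k'}" .
    \<comment> \<open>Positive widths make the intervals nonempty, so their endpoints are
      determined.\<close>
    with k have *: "a = a'" "k = k'" by (auto simp: Icc_eq_Icc)
    moreover have "inj (map_prod id ((+) a') :: 'a \<times> nat \<Rightarrow> _)"
      by (intro prod.inj_map) auto
    ultimately show "k = k' \<and> a = a' \<and> C = C'"
      using eq by (simp add: inj_image_eq_iff)
  qed
  show "(\<lambda>(k, a, C). map_prod id ((+) a) ` C) `
      (SIGMA k:{1..n}. {..n - k} \<times> spanning_conn_sets G k)
      \<subseteq> conn_sets (cart_prod G (path_graph n))"
    by (auto simp: spanning_conn_sets_def intro!: translate_conn_set)
  show "conn_sets (cart_prod G (path_graph n)) \<subseteq> (\<lambda>(k, a, C). map_prod id ((+) a) ` C) `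
      (SIGMA k:{1..n}. {..n - k} \<times> spanning_conn_sets G k)"
  proof
    fix C assume C: "C \<in> conn_sets (cart_prod G (path_graph n))"
    obtain a k where k: "1 \<le> k" "a + k \<le> n" and cols: "snd ` C = {a + 1..a + k}"
      using C by (rule snd_image_conn_set_interval)
    define D where "D = map_prod id (\<lambda>j. j - a) ` C"
    have "snd ` D = (\<lambda>j. j - a) ` (snd ` C)"
      by (simp add: D_def image_image)
    also have "\<dots> = {1..k}"
      unfolding cols by (force simp: image_iff intro: bexI[of _ "_ + a"])
    finally have "D \<in> spanning_conn_sets G k"
      using untranslate_conn_set[OF C cols] by (simp add: spanning_conn_sets_def D_def)
    moreover have "map_prod id ((+) a) ` D = C"
    proof -
      have "map_prod id ((+) a) (map_prod id (\<lambda>j. j - a) u) = u" if "u \<in> C" for u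
        using imageI[OF that, of snd] cols by (cases u) auto
      then show ?thesis by (simp add: D_def image_image)
    qed
    ultimately show "C \<in> (\<lambda>(k, a, C). map_prod id ((+) a) ` C) `
        (SIGMA k:{1..n}. {..n - k} \<times> spanning_conn_sets G k)"
      using k by (intro image_eqI[of _ _ "(k, a, D)"]) auto
  qed
qed

text \<open>The factor \<open>n - k + 1\<close> is the number of offsets in
  \<open>{..n - k}\<close>.\<close>

lemma num_conn_sets_cart_prod_path_graph:
  assumes "finite (pverts G)"
  shows "num_conn_sets (cart_prod G (path_graph n)) =
    (\<Sum>k=1..n. card (spanning_conn_sets G k) * (n - k + 1))"
proof -
  have "finite (conn_sets (cart_prod G (path_graph k)))" for k
    using assms by (intro finite_conn_sets) (simp add: cart_prod_def path_graph_def)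
  then have "finite (spanning_conn_sets G k)" for k
    by (simp add: spanning_conn_sets_def)
  then have "card (SIGMA k:{1..n}. {..n - k} \<times> spanning_conn_sets G k) =
      (\<Sum>k=1..n. card (spanning_conn_sets G k) * (n - k + 1))"
    by (subst card_SigmaI) (auto simp: card_cartesian_product mult.commute)
  then show ?thesis
    using bij_betw_same_card[OF bij_betw_translate[of n G]] by (simp add: num_conn_sets_def)
qed

text \<open>With only three rows, \<open>column j\<close> contains every point of \<open>C\<close>
  whose second coordinate is \<open>j\<close>.\<close>

lemma meets_all_columns_iff:
  assumes "C \<subseteq> {1..3} \<times> {1..k}"
  shows "meets_all_columns k C \<longleftrightarrow> snd ` C = {1..k}"
proof -
  have "C \<inter> column j \<noteq> {} \<longleftrightarrow> j \<in> snd ` C" for j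
  proof
    assume "j \<in> snd ` C"
    then obtain i where i: "(i, j) \<in> C" by force
    with assms have "i = 1 \<or> i = 2 \<or> i = 3" by fastforce
    with i show "C \<inter> column j \<noteq> {}" by (auto simp: column_def)
  qed (force simp: column_def)
  then show ?thesis
    using assms by (auto simp: meets_all_columns_def)
qed

text \<open>Since \<open>path_graph 3\<close> is a spanning subgraph of
  \<open>complete_graph 3\<close>, the sets counted by \<open>N3 k\<close> split according to
  whether they are already connected over the path. The additive form avoids truncated
  subtraction.\<close>

lemma card_spanning_conn_sets_path_graph_3:
  "card (spanning_conn_sets (path_graph 3) k) + card (C3' k) = N3 k"
proof -
  let ?K = "cart_prod (complete_graph 3) (path_graph k)"
  let ?P = "cart_prod (path_graph 3) (path_graph k)"
  have verts: "pverts ?K = {1..3} \<times> {1..k}" "pverts ?P = {1..3} \<times> {1..k}"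
    by (simp_all add: cart_prod_def complete_graph_def path_graph_def)
  have "parcs ?P \<subseteq> parcs ?K"
    by (auto simp: cart_prod_def complete_graph_def path_graph_def)
  then have sub: "conn_sets ?P \<subseteq> conn_sets ?K"
  proof (intro subsetI)
    fix C assume "C \<in> conn_sets ?P"
    with \<open>parcs ?P \<subseteq> parcs ?K\<close> show "C \<in> conn_sets ?K"
      using conn_sets_image[of C ?P id ?K] verts by (auto simp: conn_sets_def)
  qed
  have span: "spanning_conn_sets (path_graph 3) k = {C \<in> conn_sets ?P. meets_all_columns k C}"
    using verts by (auto simp: spanning_conn_sets_def conn_sets_iff meets_all_columns_iff)
  have fin: "finite (conn_sets ?K)"
    using verts by (intro finite_conn_sets) simp
  have "{C \<in> conn_sets ?K. meets_all_columns k C} =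
      spanning_conn_sets (path_graph 3) k \<union> C3' k"
    using sub by (auto simp: span C3'_def)
  moreover have "finite (spanning_conn_sets (path_graph 3) k)" "finite (C3' k)"
    using fin finite_subset[OF sub fin] by (simp_all add: span C3'_def)
  moreover have "spanning_conn_sets (path_graph 3) k \<inter> C3' k = {}"
    by (auto simp: span C3'_def)
  ultimately show ?thesis
    by (simp add: N3_def card_Un_disjoint)
qed

theorem theorem4p3:
  fixes n :: nat
  assumes "n \<ge> 1"
  shows "int (num_conn_sets (cart_prod (path_graph 3) (path_graph n))) =
    (\<Sum>k=1..n. (int (N3 k) - int (card (C3' k))) * (int n - int k + 1))"
proof -
  have "finite (pverts (path_graph 3))" by (simp add: path_graph_def)
  then have "int (num_conn_sets (cart_prod (path_graph 3) (path_graph n))) =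
      (\<Sum>k=1..n. int (card (spanning_conn_sets (path_graph 3) k) * (n - k + 1)))"
    by (simp add: num_conn_sets_cart_prod_path_graph del: of_nat_mult)
  also have "\<dots> = (\<Sum>k=1..n. (int (N3 k) - int (card (C3' k))) * (int n - int k + 1))"
  proof (intro sum.cong refl)
    fix k assume "k \<in> {1..n}"
    \<comment> \<open>Here \<open>k\<close> is at most \<open>n\<close>, so the natural subtraction
      agrees with the integer one.\<close>
    then have "int (n - k + 1) = int n - int k + 1" by simp
    then show "int (card (spanning_conn_sets (path_graph 3) k) * (n - k + 1)) =
        (int (N3 k) - int (card (C3' k))) * (int n - int k + 1)"
      unfolding of_nat_mult by (simp flip: card_spanning_conn_sets_path_graph_3)
  qed
  finally show ?thesis .
qed

end
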